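(* Let $\mathbb{X}$ be a real normed linear space such that its dual $\mathbb{X}^{*}$ is strictly convex. Let $f,g\in\mathbb{X}^{*}$ be such that $f\perp_B g$. Then \begin{align*} \|f\|&=\sup\{f(x):x\in S_{\mathbb{X}},\ g(x)\ge 0\}\\ &=\sup\{f(x):x\in S_{\mathbb{X}},\ g(x)\le 0\}. \end{align*}
   Context: All normed spaces are real; $S_{\mathbb{X}}=\{x\in\mathbb{X}:\|x\|=1\}$, and $\mathbb{X}^{*}$ is the space of bounded linear functionals with the dual norm. A normed space is strictly convex if every point of its unit sphere is an extreme point of its closed unit ball. $f\perp_B g$ (Birkhoff-James orthogonality) means $\|f+\lambda g\|\ge\|f\|$ for all $\lambda\in\mathbb{R}$. *)

theory Defs
  imports "HOL-Analysis.Analysis"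
begin

text \<open>
  A property of a space carried by a whole type, hence the \<open>itself\<close> argument.
\<close>

definition strictly_convex_space :: "'a::real_normed_vector itself \<Rightarrow> bool" where
  "strictly_convex_space _ \<longleftrightarrow>
     (\<forall>x \<in> sphere (0::'a) 1. x extreme_point_of cball 0 1)"

definition birkhoff_orthogonal :: "'a::real_normed_vector \<Rightarrow> 'a \<Rightarrow> bool"
    (infix "\<bottom>\<^sub>B" 50) where
  "f \<bottom>\<^sub>B g \<longleftrightarrow> (\<forall>l::real. norm (f + l *\<^sub>R g) \<ge> norm f)"

end

theory Submission
  imports Defs
begin

text \<open>
  For small \<open>t > 0\<close> a unit vector that almost norms \<open>f + t g\<close>, up to \<open>t\<^sup>2\<close>, also almost
  norms \<open>f\<close>, and \<open>\<parallel>f + t g\<parallel> \<ge> \<parallel>f\<parallel>\<close> forces \<open>g \<ge> -t\<close> there. A perturbation of size \<open>O(t)\<close>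
  along a direction where \<open>g\<close> is positive moves this vector into the half space \<open>g \<ge> 0\<close>, and
  letting \<open>t\<close> tend to 0 gives the first supremum. The second follows by replacing \<open>g\<close> by \<open>-g\<close>.
\<close>

text \<open>If \<open>r\<close> bounded \<open>h\<close> on the unit sphere, then replacing
  \<open>x\<close> by \<open>-x\<close> would make it bound the absolute value of \<open>h\<close>
  there, hence \<open>norm h\<close>. A nonzero vector is needed so that the sphere is inhabited,
  which forces \<open>0 \<le> r\<close>.\<close>

lemma blinfun_unit_vector_gt:
  fixes h :: "'a::real_normed_vector \<Rightarrow>\<^sub>L real"
  assumes "\<exists>x::'a. x \<noteq> 0" and r: "r < norm h"
  obtains x where "norm x = 1" "r < blinfun_apply h x"
proof -
  have "\<exists>x. norm x = 1 \<and> r < blinfun_apply h x"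
  proof (rule ccontr)
    assume "\<not> ?thesis"
    then have le: "blinfun_apply h x \<le> r" if "norm x = 1" for x
      using that by force
    have abs_le: "\<bar>blinfun_apply h x\<bar> \<le> r" if "norm x = 1" for x
      using le[of x] le[of "-x"] that by (simp add: blinfun.minus_right)
    obtain u :: 'a where "u \<noteq> 0" using assms(1) by blast
    then have "norm (sgn u) = 1" by (simp add: norm_sgn)
    then have "0 \<le> r" using abs_le[of "sgn u"] by linarith
    have "norm (blinfun_apply h x) \<le> r * norm x" for x
    proof (cases "x = 0")
      case False
      then have "\<bar>blinfun_apply h (sgn x)\<bar> \<le> r" by (intro abs_le) (simp add: norm_sgn)
      with False show ?thesis
        by (simp add: sgn_div_norm blinfun.scaleR_right abs_mult field_simps)
    qed simp
    then have "norm h \<le> r" by (rule norm_blinfun_bound[OF \<open>0 \<le> r\<close>])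
    with r show False by simp
  qed
  with that show thesis by blast
qed

lemma birkhoff_orthogonal_minus_right:
  "f \<bottom>\<^sub>B g \<Longrightarrow> f \<bottom>\<^sub>B - g"
  unfolding birkhoff_orthogonal_def
  by (metis scaleR_minus_left scaleR_minus_right)

lemma birkhoff_orthogonal_unit_vector_gt:
  fixes f g :: "'a::real_normed_vector \<Rightarrow>\<^sub>L real"
  assumes nontriv: "\<exists>x::'a. x \<noteq> 0" and orth: "f \<bottom>\<^sub>B g" and c: "c < norm f"
  obtains x where "norm x = 1" "0 \<le> blinfun_apply g x" "c < blinfun_apply f x"
proof (cases "g = 0")
  case True
  with blinfun_unit_vector_gt[OF nontriv c] that show thesis by auto
next
  case False
  then obtain y where y: "norm y = 1" "0 < blinfun_apply g y"
    using blinfun_unit_vector_gt[OF nontriv, of 0 g] by auto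
  define b where "b = blinfun_apply g y"
  have b: "0 < b" using y by (simp add: b_def)
  have "\<exists>x. norm x = 1 \<and> 0 \<le> blinfun_apply g x \<and> c < blinfun_apply f x"
  proof (rule ccontr)
    assume "\<not> ?thesis"
    then have unit_le: "blinfun_apply f x \<le> c" if "norm x = 1" "0 \<le> blinfun_apply g x" for x
      using that by force
    \<comment> \<open>Homogeneity carries the bound from unit vectors to the whole half space, so
      the perturbed vector \<open>z\<close> below need not be normalized.\<close>
    have le: "blinfun_apply f z \<le> c * norm z" if "0 \<le> blinfun_apply g z" for z
    proof (cases "z = 0")
      case False
      then have "blinfun_apply f (sgn z) \<le> c"
        using that by (intro unit_le) (auto simp: norm_sgn sgn_div_norm blinfun.scaleR_right)
      with False show ?thesis
        by (simp add: sgn_div_norm blinfun.scaleR_right field_simps)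
    qed simp
    \<comment> \<open>The losses are \<open>t\<^sup>2\<close> from almost norming
      \<open>f + t *\<^sub>R g\<close>, \<open>t * norm g\<close> from discarding \<open>g\<close>,
      \<open>t / b * norm f\<close> from the change of \<open>f\<close> under the perturbation, and
      \<open>\<bar>c\<bar> * (t / b)\<close> from the change of norm.\<close>
    have bound: "norm f - t\<^sup>2 - t * norm g - t / b * norm f \<le> c + \<bar>c\<bar> * (t / b)" if t: "0 < t" for t
    proof -
      have "norm f - t\<^sup>2 < norm (f + t *\<^sub>R g)"
        using orth t unfolding birkhoff_orthogonal_def by (smt (verit) zero_less_power)
      then obtain x where x: "norm x = 1"
        and "norm f - t\<^sup>2 < blinfun_apply (f + t *\<^sub>R g) x"
        using blinfun_unit_vector_gt[OF nontriv] by blast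
      then have fgx: "norm f - t\<^sup>2 < blinfun_apply f x + t * blinfun_apply g x"
        by (simp add: blinfun.add_left blinfun.scaleR_left)
      have fx: "\<bar>blinfun_apply f x\<bar> \<le> norm f" and fy: "\<bar>blinfun_apply f y\<bar> \<le> norm f"
        and gx: "\<bar>blinfun_apply g x\<bar> \<le> norm g"
        using norm_blinfun[of f x] norm_blinfun[of f y] norm_blinfun[of g x] x y(1) by auto
      \<comment> \<open>Since \<open>f\<close> is at most \<open>norm f\<close> at \<open>x\<close>,
        the term \<open>t * blinfun_apply g x\<close> must exceed \<open>- t\<^sup>2\<close>. The
        quadratic slack leaves an error of order \<open>t\<close> after division by
        \<open>t\<close>.\<close>
      have "t * (- t) < t * blinfun_apply g x"
        using fgx fx by (simp add: power2_eq_square)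
      then have g_gt: "- t < blinfun_apply g x" using t by (simp only: mult_less_cancel_left_pos)
      \<comment> \<open>This size makes \<open>g\<close> gain exactly \<open>t\<close> along
        \<open>s *\<^sub>R y\<close>, which offsets the lower bound \<open>- t\<close>.\<close>
      define s where "s = t / b"
      have s: "0 < s" using t b by (simp add: s_def)
      define z where "z = x + s *\<^sub>R y"
      have "blinfun_apply g z = blinfun_apply g x + t"
        using b by (simp add: z_def s_def b_def blinfun.add_right blinfun.scaleR_right)
      with g_gt have "blinfun_apply f z \<le> c * norm z" by (intro le) simp
      also have "\<dots> = c + c * (norm z - 1)" by (simp add: algebra_simps)
      \<comment> \<open>The sign of \<open>c\<close> is unknown, so the deviation of
        \<open>norm z\<close> from 1 is estimated on both sides.\<close>
      also have "\<dots> \<le> c + \<bar>c\<bar> * \<bar>norm z - 1\<bar>" by (simp add: abs_mult[symmetric])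
      also have "\<bar>norm z - 1\<bar> \<le> s"
        using norm_triangle_ineq3[of z x] x y(1) s by (simp add: z_def)
      finally have "blinfun_apply f z \<le> c + \<bar>c\<bar> * s" by (simp add: mult_left_mono)
      moreover have "blinfun_apply f z = blinfun_apply f x + s * blinfun_apply f y"
        by (simp add: z_def blinfun.add_right blinfun.scaleR_right)
      moreover have "s * (- norm f) \<le> s * blinfun_apply f y"
        using fy s by (intro mult_left_mono) auto
      moreover have "t * blinfun_apply g x \<le> t * norm g"
        using gx t by (intro mult_left_mono) auto
      ultimately show ?thesis using fgx unfolding s_def[symmetric] by linarith
    qed
    \<comment> \<open>The limit is taken from the right because \<open>bound\<close> holds for
      positive \<open>t\<close>; it yields \<open>norm f \<le> c\<close>, against the choice of
      \<open>c\<close>.\<close>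
    have "((\<lambda>t. norm f - t\<^sup>2 - t * norm g - t / b * norm f) \<longlongrightarrow>
        norm f - 0\<^sup>2 - 0 * norm g - 0 / b * norm f) (at_right 0)"
      using b by (intro tendsto_intros) auto
    moreover have "((\<lambda>t. c + \<bar>c\<bar> * (t / b)) \<longlongrightarrow> c + \<bar>c\<bar> * (0 / b)) (at_right 0)"
      using b by (intro tendsto_intros) auto
    moreover have "\<forall>\<^sub>F t in at_right 0.
        norm f - t\<^sup>2 - t * norm g - t / b * norm f \<le> c + \<bar>c\<bar> * (t / b)"
      using bound by (auto simp: eventually_at_right_field intro: exI[of _ 1])
    ultimately have "norm f - 0\<^sup>2 - 0 * norm g - 0 / b * norm f \<le> c + \<bar>c\<bar> * (0 / b)"
      by (intro tendsto_le[of "at_right (0::real)"]) auto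
    with c show False by simp
  qed
  with that show thesis by blast
qed

text \<open>The operator norm bounds the set above, and every \<open>u\<close> below
  \<open>norm f\<close> is exceeded by a unit vector of the half space.\<close>

lemma birkhoff_orthogonal_norm_eq_Sup:
  fixes f g :: "'a::real_normed_vector \<Rightarrow>\<^sub>L real"
  assumes "\<exists>x::'a. x \<noteq> 0" and "f \<bottom>\<^sub>B g"
  shows "norm f = Sup {blinfun_apply f x |x. x \<in> sphere 0 1 \<and> blinfun_apply g x \<ge> 0}"
    (is "_ = Sup ?S")
proof (rule sym, rule cSup_eq)
  fix v assume "v \<in> ?S"
  then obtain x where "v = blinfun_apply f x" "norm x = 1" by auto
  then show "v \<le> norm f" using norm_blinfun[of f x] by auto
next
  fix u assume u: "\<And>v. v \<in> ?S \<Longrightarrow> v \<le> u"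
  show "norm f \<le> u"
  proof (rule ccontr)
    assume "\<not> norm f \<le> u"
    then obtain x where "norm x = 1" "0 \<le> blinfun_apply g x" "u < blinfun_apply f x"
      using birkhoff_orthogonal_unit_vector_gt[OF assms, of u] by auto
    then show False using u[of "blinfun_apply f x"] by force
  qed
qed

theorem theorem2p7:
  fixes f g :: "'a::real_normed_vector \<Rightarrow>\<^sub>L real"
  assumes nontrivial: "\<exists>x::'a. x \<noteq> 0"
    and dual_strictly_convex: "strictly_convex_space TYPE('a \<Rightarrow>\<^sub>L real)"
    and orth: "f \<bottom>\<^sub>B g"
  shows "norm f = Sup {blinfun_apply f x |x. x \<in> sphere 0 1 \<and> blinfun_apply g x \<ge> 0} \<and>
         norm f = Sup {blinfun_apply f x |x. x \<in> sphere 0 1 \<and> blinfun_apply g x \<le> 0}"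
  using birkhoff_orthogonal_norm_eq_Sup[OF nontrivial orth]
    birkhoff_orthogonal_norm_eq_Sup[OF nontrivial birkhoff_orthogonal_minus_right[OF orth]]
  by (simp add: blinfun.minus_left)

end
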